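(* Let $X$ be a set with $|X|>\mathfrak{c}$, where $\mathfrak c=2^{\aleph_0}$. Let $S_X$ be the symmetric group on $X$ equipped with the group topology $\tau_{\mathfrak c}$, let $a\in X$, and let $H=\mathrm{St}_a=\{f\in S_X: f(a)=a\}$. Then both uniformities $\mathcal{U}_l(S_X/H)$ and $\mathcal{U}_r(S_X/H)$ are compatible with the quotient topology on $S_X/H$: each of them generates the discrete topology on $S_X/H$, and this is the quotient topology.
   Context: For a topological group $G$, the left uniformity $\mathcal{U}_l(G)$ has as a basis the entourages $V_l=\{(x,y)\in G\times G: x^{-1}y\in V\}$, and the right uniformity $\mathcal{U}_r(G)$ has as a basis the entourages $V_r=\{(x,y)\in G\times G: xy^{-1}\in V\}$, where $V$ runs over neighborhoods of the identity. For a subgroup $H$ of $G$, let $G/H=\{gH:g\in G\}$ and let $\pi:G\to G/H$ be the quotient map $g\mapsto gH$. The left uniform structure $\mathcal{U}_l(G/H)$ (respectively the right uniform structure $\mathcal{U}_r(G/H)$) is the finest uniformity on $G/H$ such that $\pi:(G,\mathcal{U}_l(G))\to G/H$ (respectively $\pi:(G,\mathcal{U}_r(G))\to G/H$) is uniformly continuous. For a set $X$, $S_X$ is the group of all bijections of $X$ onto itself (under composition). For a partition $\gamma$ of $X$, $\mathrm{St}_\gamma=\{f\in S_X: f(B)=B \text{ for all } B\in\gamma\}$. The topology $\tau_{\mathfrak c}$ on $S_X$ is the group topology for which the subgroups $\mathrm{St}_\gamma$, with $\gamma$ running over all partitions of $X$ with $|\gamma|\le\mathfrak c$, form a basis of neighborhoods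 of the identity. *)

theory Defs
  imports
    "HOL-Analysis.Analysis"
    "HOL-Algebra.Bij"
    "HOL-Algebra.Left_Coset"
begin

section \<open>Uniformities on a set\<close>

text \<open>The library only has uniformities on whole types (class \<open>uniform_space\<close>), so entourage systems
  on a carrier set are introduced here. No separation axiom is imposed.\<close>

definition uniformity_on :: "'a set \<Rightarrow> ('a \<times> 'a) set set \<Rightarrow> bool" where
  "uniformity_on S \<U> \<longleftrightarrow>
     S \<times> S \<in> \<U> \<and>
     (\<forall>E\<in>\<U>. E \<subseteq> S \<times> S \<and> Id_on S \<subseteq> E) \<and>
     (\<forall>E\<in>\<U>. \<forall>E'. E \<subseteq> E' \<and> E' \<subseteq> S \<times> S \<longrightarrow> E' \<in> \<U>) \<and>
     (\<forall>E\<in>\<U>. \<forall>E'\<in>\<U>. E \<inter> E' \<in> \<U>) \<and>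
     (\<forall>E\<in>\<U>. E\<inverse> \<in> \<U>) \<and>
     (\<forall>E\<in>\<U>. \<exists>D\<in>\<U>. D O D \<subseteq> E)"

definition uniformly_continuous_wrt ::
    "'a set \<Rightarrow> ('a \<times> 'a) set set \<Rightarrow> ('b \<times> 'b) set set \<Rightarrow> ('a \<Rightarrow> 'b) \<Rightarrow> bool" where
  "uniformly_continuous_wrt S \<U> \<V> f \<longleftrightarrow>
     (\<forall>E\<in>\<V>. {(x, y) \<in> S \<times> S. (f x, f y) \<in> E} \<in> \<U>)"

definition uniform_topology :: "'a set \<Rightarrow> ('a \<times> 'a) set set \<Rightarrow> 'a topology" where
  "uniform_topology S \<U> = topology (\<lambda>W. W \<subseteq> S \<and> (\<forall>x\<in>W. \<exists>E\<in>\<U>. E `` {x} \<subseteq> W))"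

lemma openin_uniform_topology:
  assumes "uniformity_on S \<U>"
  shows "openin (uniform_topology S \<U>) W \<longleftrightarrow> W \<subseteq> S \<and> (\<forall>x\<in>W. \<exists>E\<in>\<U>. E `` {x} \<subseteq> W)"
proof -
  have "istopology (\<lambda>W. W \<subseteq> S \<and> (\<forall>x\<in>W. \<exists>E\<in>\<U>. E `` {x} \<subseteq> W))"
    unfolding istopology_def
  proof (intro conjI allI impI ballI)
    fix V W x
    assume V: "V \<subseteq> S \<and> (\<forall>x\<in>V. \<exists>E\<in>\<U>. E `` {x} \<subseteq> V)"
      and W: "W \<subseteq> S \<and> (\<forall>x\<in>W. \<exists>E\<in>\<U>. E `` {x} \<subseteq> W)" and x: "x \<in> V \<inter> W"
    obtain D where D: "D \<in> \<U>" "D `` {x} \<subseteq> V" using V x by blast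
    obtain E where E: "E \<in> \<U>" "E `` {x} \<subseteq> W" using W x by blast
    have "D \<inter> E \<in> \<U>"
      using assms[unfolded uniformity_on_def] D(1) E(1) by meson
    moreover have "(D \<inter> E) `` {x} \<subseteq> V \<inter> W" using D(2) E(2) by blast
    ultimately show "\<exists>E\<in>\<U>. E `` {x} \<subseteq> V \<inter> W" by blast
  next
    fix V W
    assume "V \<subseteq> S \<and> (\<forall>x\<in>V. \<exists>E\<in>\<U>. E `` {x} \<subseteq> V)"
    then show "V \<inter> W \<subseteq> S" by (meson inf.coboundedI1)
  next
    fix \<K>
    assume K: "\<forall>K\<in>\<K>. K \<subseteq> S \<and> (\<forall>x\<in>K. \<exists>E\<in>\<U>. E `` {x} \<subseteq> K)"
    then show "\<Union>\<K> \<subseteq> S" by (meson Sup_least)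
    fix x assume "x \<in> \<Union>\<K>"
    then obtain K where "K \<in> \<K>" "x \<in> K" by auto
    then obtain E where "E \<in> \<U>" "E `` {x} \<subseteq> K" using K by meson
    then show "\<exists>E\<in>\<U>. E `` {x} \<subseteq> \<Union>\<K>" using \<open>K \<in> \<K>\<close> by (meson Union_upper subset_trans)
  qed
  then show ?thesis by (simp add: uniform_topology_def topology_inverse')
qed

definition uniformity_compatible :: "'a set \<Rightarrow> ('a \<times> 'a) set set \<Rightarrow> 'a topology \<Rightarrow> bool" where
  "uniformity_compatible S \<U> T \<longleftrightarrow> uniformity_on S \<U> \<and> uniform_topology S \<U> = T"

definition is_final_uniformity ::
    "'a set \<Rightarrow> ('a \<times> 'a) set set \<Rightarrow> 'b set \<Rightarrow> ('a \<Rightarrow> 'b) \<Rightarrow> ('b \<times> 'b) set set \<Rightarrow> bool" where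
  "is_final_uniformity S \<U> S' f \<V> \<longleftrightarrow>
     uniformity_on S' \<V> \<and> uniformly_continuous_wrt S \<U> \<V> f \<and>
     (\<forall>\<W>. uniformity_on S' \<W> \<and> uniformly_continuous_wrt S \<U> \<W> f \<longrightarrow> \<W> \<subseteq> \<V>)"

definition final_uniformity ::
    "'a set \<Rightarrow> ('a \<times> 'a) set set \<Rightarrow> 'b set \<Rightarrow> ('a \<Rightarrow> 'b) \<Rightarrow> ('b \<times> 'b) set set" where
  "final_uniformity S \<U> S' f = (THE \<V>. is_final_uniformity S \<U> S' f \<V>)"

lemma final_uniformity_unique:
  assumes "is_final_uniformity S \<U> S' f \<V>"
  shows "final_uniformity S \<U> S' f = \<V>"
  unfolding final_uniformity_def
  by (rule the_equality) (use assms in \<open>auto simp: is_final_uniformity_def\<close>)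

lemma is_final_uniformity_final_uniformity:
  assumes U: "uniformity_on S \<U>" and f: "f ` S \<subseteq> S'"
  shows "is_final_uniformity S \<U> S' f (final_uniformity S \<U> S' f)"
proof -
  define pb where "pb E = {(x, y) \<in> S \<times> S. (f x, f y) \<in> E}" for E
  define P where "P F \<longleftrightarrow> (\<forall>E\<in>F. E \<subseteq> S' \<times> S' \<and> Id_on S' \<subseteq> E \<and> pb E \<in> \<U> \<and>
      (\<exists>D\<in>F. D O D \<subseteq> E \<and> D \<subseteq> E\<inverse>))" for F
  define \<V> where "\<V> = \<Union>{F. P F}"
  have PV: "P \<V>"
    unfolding P_def
  proof
    fix E assume "E \<in> \<V>"
    then obtain F where F: "P F" "E \<in> F" by (auto simp: \<V>_def)
    have "F \<subseteq> \<V>" using F by (auto simp: \<V>_def)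
    then show "E \<subseteq> S' \<times> S' \<and> Id_on S' \<subseteq> E \<and> pb E \<in> \<U> \<and> (\<exists>D\<in>\<V>. D O D \<subseteq> E \<and> D \<subseteq> E\<inverse>)"
    proof (intro conjI)
      have *: "E \<subseteq> S' \<times> S' \<and> Id_on S' \<subseteq> E \<and> pb E \<in> \<U> \<and> (\<exists>D\<in>F. D O D \<subseteq> E \<and> D \<subseteq> E\<inverse>)"
        using F(1)[unfolded P_def] F(2) by (rule bspec)
      then show "E \<subseteq> S' \<times> S'" "Id_on S' \<subseteq> E" "pb E \<in> \<U>" by simp_all
      from * obtain D where "D \<in> F" "D O D \<subseteq> E \<and> D \<subseteq> E\<inverse>" by blast
      then show "\<exists>D\<in>\<V>. D O D \<subseteq> E \<and> D \<subseteq> E\<inverse>" using \<open>F \<subseteq> \<V>\<close> by blast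
    qed
  qed
  note PV' = bspec[OF PV[unfolded P_def]]
  have VI: "E \<in> \<V>" if "P F" "E \<in> F" for E F
    using that by (auto simp: \<V>_def)
  have Usup: "E' \<in> \<U>" if "E \<in> \<U>" "E \<subseteq> E'" "E' \<subseteq> S \<times> S" for E E'
    using U that unfolding uniformity_on_def by meson
  have Uint: "E \<inter> E' \<in> \<U>" if "E \<in> \<U>" "E' \<in> \<U>" for E E'
    using U that unfolding uniformity_on_def by meson
  have full: "S' \<times> S' \<in> \<V>"
  proof (rule VI)
    have "pb (S' \<times> S') = S \<times> S" using f by (auto simp: pb_def)
    moreover have "S \<times> S \<in> \<U>" using U by (simp add: uniformity_on_def)
    ultimately show "P {S' \<times> S'}" by (auto simp: P_def)
  qed simp
  have sup: "E' \<in> \<V>" if "E \<in> \<V>" "E \<subseteq> E'" "E' \<subseteq> S' \<times> S'" for E E'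
  proof (rule VI)
    show "P {E'. \<exists>E\<in>\<V>. E \<subseteq> E' \<and> E' \<subseteq> S' \<times> S'}"
      unfolding P_def
    proof
      fix E' assume "E' \<in> {E'. \<exists>E\<in>\<V>. E \<subseteq> E' \<and> E' \<subseteq> S' \<times> S'}"
      then obtain E where E: "E \<in> \<V>" "E \<subseteq> E'" "E' \<subseteq> S' \<times> S'" by blast
      have *: "Id_on S' \<subseteq> E" "pb E \<in> \<U>" "\<exists>D\<in>\<V>. D O D \<subseteq> E \<and> D \<subseteq> E\<inverse>"
        using PV'[OF E(1)] by simp_all
      then obtain D where D: "D \<in> \<V>" "D O D \<subseteq> E" "D \<subseteq> E\<inverse>" by blast
      have "D \<subseteq> S' \<times> S'" using PV'[OF D(1)] by simp
      then have "D \<in> {E'. \<exists>E\<in>\<V>. E \<subseteq> E' \<and> E' \<subseteq> S' \<times> S'}" using D(1) by auto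
      moreover have "D O D \<subseteq> E'" "D \<subseteq> E'\<inverse>" using D E by auto
      moreover have "pb E' \<in> \<U>"
        by (rule Usup[OF *(2)]) (use E in \<open>auto simp: pb_def\<close>)
      ultimately show "E' \<subseteq> S' \<times> S' \<and> Id_on S' \<subseteq> E' \<and> pb E' \<in> \<U> \<and>
          (\<exists>D\<in>{E'. \<exists>E\<in>\<V>. E \<subseteq> E' \<and> E' \<subseteq> S' \<times> S'}. D O D \<subseteq> E' \<and> D \<subseteq> E'\<inverse>)"
        using *(1) E by blast
    qed
  qed (use that in auto)
  have int: "E \<inter> E' \<in> \<V>" if "E \<in> \<V>" "E' \<in> \<V>" for E E'
  proof (rule VI)
    show "P {E \<inter> E' | E E'. E \<in> \<V> \<and> E' \<in> \<V>}"
      unfolding P_def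
    proof
      fix C assume "C \<in> {E \<inter> E' | E E'. E \<in> \<V> \<and> E' \<in> \<V>}"
      then obtain A B where AB: "A \<in> \<V>" "B \<in> \<V>" and C: "C = A \<inter> B" by blast
      have A: "A \<subseteq> S' \<times> S'" "Id_on S' \<subseteq> A" "pb A \<in> \<U>" "\<exists>D\<in>\<V>. D O D \<subseteq> A \<and> D \<subseteq> A\<inverse>"
        using PV'[OF AB(1)] by simp_all
      have B: "Id_on S' \<subseteq> B" "pb B \<in> \<U>" "\<exists>D\<in>\<V>. D O D \<subseteq> B \<and> D \<subseteq> B\<inverse>"
        using PV'[OF AB(2)] by simp_all
      obtain D where D: "D \<in> \<V>" "D O D \<subseteq> A" "D \<subseteq> A\<inverse>" using A by blast
      obtain D' where D': "D' \<in> \<V>" "D' O D' \<subseteq> B" "D' \<subseteq> B\<inverse>" using B by blast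
      have "pb (A \<inter> B) = pb A \<inter> pb B" by (auto simp: pb_def)
      then have pb: "pb (A \<inter> B) \<in> \<U>" using Uint A B by simp
      have "D \<inter> D' \<in> {E \<inter> E' | E E'. E \<in> \<V> \<and> E' \<in> \<V>}" using D D' by blast
      moreover have "(D \<inter> D') O (D \<inter> D') \<subseteq> A \<inter> B" "D \<inter> D' \<subseteq> (A \<inter> B)\<inverse>"
        using D D' by auto
      ultimately show "C \<subseteq> S' \<times> S' \<and> Id_on S' \<subseteq> C \<and> pb C \<in> \<U> \<and>
          (\<exists>D\<in>{E \<inter> E' | E E'. E \<in> \<V> \<and> E' \<in> \<V>}. D O D \<subseteq> C \<and> D \<subseteq> C\<inverse>)"
        unfolding C using A B pb by blast
    qed
  qed (use that in auto)
  have conv: "E\<inverse> \<in> \<V>" if E: "E \<in> \<V>" for E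
  proof -
    obtain D where "D \<in> \<V>" "D \<subseteq> E\<inverse>" "E \<subseteq> S' \<times> S'" using PV'[OF E] by blast
    then show ?thesis using sup[of D "E\<inverse>"] by auto
  qed
  have "is_final_uniformity S \<U> S' f \<V>"
    unfolding is_final_uniformity_def
  proof (intro conjI allI impI)
    show "uniformity_on S' \<V>"
      unfolding uniformity_on_def
    proof (intro conjI ballI allI impI)
      show "S' \<times> S' \<in> \<V>" by (rule full)
      fix E assume E: "E \<in> \<V>"
      show "E \<subseteq> S' \<times> S'" "Id_on S' \<subseteq> E" using PV'[OF E] by simp_all
      show "\<exists>D\<in>\<V>. D O D \<subseteq> E" using PV'[OF E] by blast
      show "E\<inverse> \<in> \<V>" using E by (rule conv)
      show "E' \<in> \<V>" if "E \<subseteq> E' \<and> E' \<subseteq> S' \<times> S'" for E' using sup[OF E] that by simp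
      show "E \<inter> E' \<in> \<V>" if "E' \<in> \<V>" for E' using int[OF E that] .
    qed
    show "uniformly_continuous_wrt S \<U> \<V> f"
      unfolding uniformly_continuous_wrt_def
    proof
      fix E assume "E \<in> \<V>"
      from PV'[OF this] have "pb E \<in> \<U>" by (elim conjE)
      then show "{(x, y) \<in> S \<times> S. (f x, f y) \<in> E} \<in> \<U>" by (simp only: pb_def)
    qed
    fix \<W> assume W: "uniformity_on S' \<W> \<and> uniformly_continuous_wrt S \<U> \<W> f"
    note Wu = W[THEN conjunct1, unfolded uniformity_on_def]
    have W1: "\<forall>E\<in>\<W>. E \<subseteq> S' \<times> S' \<and> Id_on S' \<subseteq> E" using Wu by (elim conjE)
    have W2: "\<forall>E\<in>\<W>. \<forall>E'\<in>\<W>. E \<inter> E' \<in> \<W>" using Wu by (elim conjE)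
    have W3: "\<forall>E\<in>\<W>. E\<inverse> \<in> \<W>" using Wu by (elim conjE)
    have W4: "\<forall>E\<in>\<W>. \<exists>D\<in>\<W>. D O D \<subseteq> E" using Wu by (elim conjE)
    have "P \<W>"
      unfolding P_def
    proof
      fix E assume E: "E \<in> \<W>"
      obtain D where D: "D \<in> \<W>" "D O D \<subseteq> E" using W4 E by meson
      have "D \<inter> E\<inverse> \<in> \<W>" using W2 W3 D(1) E by meson
      moreover have "(D \<inter> E\<inverse>) O (D \<inter> E\<inverse>) \<subseteq> E" using D by auto
      moreover have "E \<subseteq> S' \<times> S'" "Id_on S' \<subseteq> E" "pb E \<in> \<U>"
        using W1 W E by (simp_all add: uniformly_continuous_wrt_def pb_def)
      ultimately show "E \<subseteq> S' \<times> S' \<and> Id_on S' \<subseteq> E \<and> pb E \<in> \<U> \<and> (\<exists>D\<in>\<W>. D O D \<subseteq> E \<and> D \<subseteq> E\<inverse>)"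
        by blast
    qed
    then show "\<W> \<subseteq> \<V>" by (auto simp: \<V>_def)
  qed
  then show ?thesis by (simp add: final_uniformity_unique)
qed

section \<open>Topological groups and their coset spaces\<close>

definition neighbourhood_of :: "'a topology \<Rightarrow> 'a \<Rightarrow> 'a set \<Rightarrow> bool" where
  "neighbourhood_of T x N \<longleftrightarrow> N \<subseteq> topspace T \<and> (\<exists>W. openin T W \<and> x \<in> W \<and> W \<subseteq> N)"

definition neighbourhood_basis :: "'a topology \<Rightarrow> 'a \<Rightarrow> 'a set set \<Rightarrow> bool" where
  "neighbourhood_basis T x \<B> \<longleftrightarrow>
     (\<forall>N\<in>\<B>. neighbourhood_of T x N) \<and> (\<forall>N. neighbourhood_of T x N \<longrightarrow> (\<exists>M\<in>\<B>. M \<subseteq> N))"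

definition topological_group :: "('a, 'b) monoid_scheme \<Rightarrow> 'a topology \<Rightarrow> bool" where
  "topological_group G T \<longleftrightarrow>
     group G \<and> topspace T = carrier G \<and>
     continuous_map (prod_topology T T) T (\<lambda>(x, y). x \<otimes>\<^bsub>G\<^esub> y) \<and>
     continuous_map T T (\<lambda>x. inv\<^bsub>G\<^esub> x)"

lemma topological_group_openin_iff:
  assumes G: "topological_group G T" and B: "neighbourhood_basis T \<one>\<^bsub>G\<^esub> \<B>"
  shows "openin T U \<longleftrightarrow> U \<subseteq> carrier G \<and> (\<forall>x\<in>U. \<exists>N\<in>\<B>. x <#\<^bsub>G\<^esub> N \<subseteq> U)"
proof -
  interpret group G using G by (simp add: topological_group_def)
  have top: "topspace T = carrier G" using G by (simp add: topological_group_def)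
  have trans: "continuous_map T T (\<lambda>y. x \<otimes>\<^bsub>G\<^esub> y)" if "x \<in> carrier G" for x
  proof -
    have "continuous_map T (prod_topology T T) (\<lambda>y. (x, y))"
      using that top by (intro continuous_map_pairedI) auto
    then show ?thesis
      using G continuous_map_compose
      by (fastforce simp: topological_group_def o_def)
  qed
  have pre: "openin T {y \<in> carrier G. x \<otimes>\<^bsub>G\<^esub> y \<in> W}" if "x \<in> carrier G" "openin T W" for x W
    using openin_continuous_map_preimage[OF trans[OF that(1)] that(2)] top by simp
  show ?thesis
  proof (intro iffI conjI ballI)
    assume U: "openin T U"
    then show sub: "U \<subseteq> carrier G" using openin_subset top by auto
    fix x assume x: "x \<in> U"
    then have xc: "x \<in> carrier G" using sub by auto
    have "neighbourhood_of T \<one>\<^bsub>G\<^esub> {y \<in> carrier G. x \<otimes>\<^bsub>G\<^esub> y \<in> U}"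
      unfolding neighbourhood_of_def using pre[OF xc U] x xc top by auto
    then obtain N where "N \<in> \<B>" "N \<subseteq> {y \<in> carrier G. x \<otimes>\<^bsub>G\<^esub> y \<in> U}"
      using B unfolding neighbourhood_basis_def by meson
    then show "\<exists>N\<in>\<B>. x <#\<^bsub>G\<^esub> N \<subseteq> U" by (intro bexI[of _ N]) (auto simp: l_coset_def)
  next
    assume U: "U \<subseteq> carrier G \<and> (\<forall>x\<in>U. \<exists>N\<in>\<B>. x <#\<^bsub>G\<^esub> N \<subseteq> U)"
    show "openin T U"
    proof (subst openin_subopen, intro ballI)
      fix x assume x: "x \<in> U"
      then have xc: "x \<in> carrier G" using U by auto
      obtain N where N: "N \<in> \<B>" "x <#\<^bsub>G\<^esub> N \<subseteq> U" using U x by blast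
      then have "neighbourhood_of T \<one>\<^bsub>G\<^esub> N" using B by (simp add: neighbourhood_basis_def)
      then obtain W where W: "openin T W" "\<one>\<^bsub>G\<^esub> \<in> W" "W \<subseteq> N"
        by (auto simp: neighbourhood_of_def)
      let ?V = "{y \<in> carrier G. inv\<^bsub>G\<^esub> x \<otimes>\<^bsub>G\<^esub> y \<in> W}"
      have "?V \<subseteq> U"
      proof
        fix y assume y: "y \<in> ?V"
        then have "y = x \<otimes>\<^bsub>G\<^esub> (inv\<^bsub>G\<^esub> x \<otimes>\<^bsub>G\<^esub> y)" using xc by (simp add: m_assoc[symmetric])
        then have "y \<in> x <#\<^bsub>G\<^esub> N" using y W(3) by (auto simp: l_coset_def)
        then show "y \<in> U" using N by auto
      qed
      moreover have "openin T ?V" using pre[of "inv\<^bsub>G\<^esub> x" W] xc W(1) by simp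
      moreover have "x \<in> ?V" using xc W(2) by simp
      ultimately show "\<exists>V. openin T V \<and> x \<in> V \<and> V \<subseteq> U" by blast
    qed
  qed
qed

lemma topological_group_unique:
  assumes "topological_group G T" "neighbourhood_basis T \<one>\<^bsub>G\<^esub> \<B>"
    and "topological_group G T'" "neighbourhood_basis T' \<one>\<^bsub>G\<^esub> \<B>"
  shows "T = T'"
  by (simp add: topology_eq topological_group_openin_iff[OF assms(1,2)]
      topological_group_openin_iff[OF assms(3,4)])

lemma (in group) topological_group_from_subgroups:
  assumes ne: "\<B> \<noteq> {}" and sg: "\<And>N. N \<in> \<B> \<Longrightarrow> subgroup N G"
    and dir: "\<And>M N. M \<in> \<B> \<Longrightarrow> N \<in> \<B> \<Longrightarrow> \<exists>K\<in>\<B>. K \<subseteq> M \<inter> N"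
    and conj: "\<And>g N. g \<in> carrier G \<Longrightarrow> N \<in> \<B> \<Longrightarrow> \<exists>M\<in>\<B>. \<forall>m\<in>M. g \<otimes> m \<otimes> inv g \<in> N"
  shows "\<exists>T. topological_group G T \<and> neighbourhood_basis T \<one> \<B>"
proof -
  define P where "P U \<longleftrightarrow> U \<subseteq> carrier G \<and> (\<forall>x\<in>U. \<exists>N\<in>\<B>. x <# N \<subseteq> U)" for U
  define T where "T = topology P"
  have "istopology P"
    unfolding istopology_def
  proof (intro conjI allI impI)
    fix V W assume V: "P V" and W: "P W"
    have "\<exists>K\<in>\<B>. x <# K \<subseteq> V \<inter> W" if x: "x \<in> V" "x \<in> W" for x
    proof -
      obtain M N where MN: "M \<in> \<B>" "N \<in> \<B>" "x <# M \<subseteq> V" "x <# N \<subseteq> W"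
        using V W x unfolding P_def by meson
      with dir obtain K where "K \<in> \<B>" "K \<subseteq> M \<inter> N" by blast
      moreover have "x <# K \<subseteq> V \<inter> W"
        using MN \<open>K \<subseteq> M \<inter> N\<close> unfolding l_coset_def by fast
      ultimately show ?thesis by blast
    qed
    moreover have "V \<inter> W \<subseteq> carrier G" using V by (auto simp: P_def)
    ultimately show "P (V \<inter> W)" by (simp add: P_def)
  next
    fix \<K> assume K: "\<forall>K\<in>\<K>. P K"
    have "\<exists>N\<in>\<B>. x <# N \<subseteq> \<Union>\<K>" if xK: "K \<in> \<K>" "x \<in> K" for x K
    proof -
      obtain N where "N \<in> \<B>" "x <# N \<subseteq> K" using K xK unfolding P_def by meson
      then show ?thesis using xK by (intro bexI[of _ N]) auto
    qed
    moreover have "\<Union>\<K> \<subseteq> carrier G" using K unfolding P_def by (meson Sup_least)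
    ultimately show "P (\<Union>\<K>)" unfolding P_def by (metis UnionE)
  qed
  then have op: "openin T U \<longleftrightarrow> P U" for U by (simp add: T_def topology_inverse')
  have opE: "\<exists>N\<in>\<B>. x <# N \<subseteq> U" if "openin T U" "x \<in> U" for x U
    using that unfolding op P_def by blast
  have sub: "N \<subseteq> carrier G" if "N \<in> \<B>" for N using sg[OF that] subgroup.subset by blast
  have coset_open: "openin T (x <# N)" if x: "x \<in> carrier G" and N: "N \<in> \<B>" for x N
    unfolding op P_def
  proof (intro conjI ballI)
    show "x <# N \<subseteq> carrier G" using x sub[OF N] by (auto simp: l_coset_def)
    fix y assume "y \<in> x <# N"
    then obtain n where n: "n \<in> N" "y = x \<otimes> n" by (auto simp: l_coset_def)
    have "y <# N \<subseteq> x <# N"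
    proof
      fix z assume "z \<in> y <# N"
      then obtain m where m: "m \<in> N" "z = y \<otimes> m" by (auto simp: l_coset_def)
      then have "z = x \<otimes> (n \<otimes> m)" using n x sub[OF N] by (simp add: m_assoc subsetD)
      moreover have "n \<otimes> m \<in> N" using sg[OF N] n m by (simp add: subgroup.m_closed)
      ultimately show "z \<in> x <# N" by (auto simp: l_coset_def)
    qed
    then show "\<exists>N'\<in>\<B>. y <# N' \<subseteq> x <# N" using N by blast
  qed
  have self: "x \<in> x <# N" if "x \<in> carrier G" "N \<in> \<B>" for x N
    using sg[OF that(2)] that(1) by (simp add: lcos_self)
  have "P (carrier G)"
  proof -
    obtain N where "N \<in> \<B>" using ne by blast
    moreover have "x <# N \<subseteq> carrier G" if "x \<in> carrier G" for x
      using that sub[OF \<open>N \<in> \<B>\<close>] by (auto simp: l_coset_def)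
    ultimately show ?thesis by (auto simp: P_def)
  qed
  then have top: "topspace T = carrier G"
    by (metis P_def op openin_subset openin_topspace subset_antisym)
  have "continuous_map (prod_topology T T) T (\<lambda>(x, y). x \<otimes> y)"
    unfolding continuous_map_def
  proof (intro conjI allI impI)
    show "(\<lambda>(x, y). x \<otimes> y) \<in> topspace (prod_topology T T) \<rightarrow> topspace T" by (auto simp: top)
    fix U assume U: "openin T U"
    let ?V = "{p \<in> topspace (prod_topology T T). (\<lambda>(x, y). x \<otimes> y) p \<in> U}"
    have "\<exists>V W. openin T V \<and> openin T W \<and> x \<in> V \<and> y \<in> W \<and> V \<times> W \<subseteq> ?V"
      if xy: "(x, y) \<in> ?V" for x y
    proof -
      have c: "x \<in> carrier G" "y \<in> carrier G" "x \<otimes> y \<in> U" using xy by (auto simp: top)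
      then obtain N where N: "N \<in> \<B>" "(x \<otimes> y) <# N \<subseteq> U" using opE[OF U] by blast
      obtain M where M: "M \<in> \<B>" "\<forall>m\<in>M. inv y \<otimes> m \<otimes> inv (inv y) \<in> N"
        using conj[of "inv y" N] c N by auto
      have "(x <# M) \<times> (y <# N) \<subseteq> ?V"
      proof
        fix p assume "p \<in> (x <# M) \<times> (y <# N)"
        then obtain u v where p: "p = (u, v)" and "u \<in> x <# M" "v \<in> y <# N" by blast
        then obtain m n where m: "m \<in> M" "u = x \<otimes> m" and n: "n \<in> N" "v = y \<otimes> n"
          by (auto simp: l_coset_def)
        have mc: "m \<in> carrier G" "n \<in> carrier G" using m n sub M N by blast+
        have "u \<otimes> v = x \<otimes> y \<otimes> ((inv y \<otimes> m \<otimes> y) \<otimes> n)"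
        proof -
          have "y \<otimes> (inv y \<otimes> m \<otimes> y) = m \<otimes> y" using mc c by (simp add: m_assoc[symmetric])
          then have "x \<otimes> y \<otimes> ((inv y \<otimes> m \<otimes> y) \<otimes> n) = x \<otimes> ((m \<otimes> y) \<otimes> n)"
            using mc c by (metis inv_closed m_assoc m_closed)
          then show ?thesis using mc c m n by (simp add: m_assoc)
        qed
        moreover have "(inv y \<otimes> m \<otimes> y) \<otimes> n \<in> N"
          using M m n N c sg[OF N(1)] by (auto intro: subgroup.m_closed)
        ultimately have "u \<otimes> v \<in> U" using N by (auto simp: l_coset_def)
        then show "p \<in> ?V"
          using m n mc c by (simp add: top p)
      qed
      then show ?thesis
        using coset_open[OF c(1) M(1)] coset_open[OF c(2) N(1)] self[OF c(1) M(1)] self[OF c(2) N(1)]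
        by blast
    qed
    then show "openin (prod_topology T T) ?V"
      by (simp add: openin_prod_topology_alt)
  qed
  moreover have "continuous_map T T (\<lambda>x. inv x)"
    unfolding continuous_map_def
  proof (intro conjI allI impI)
    show "(\<lambda>x. inv x) \<in> topspace T \<rightarrow> topspace T" by (auto simp: top)
    fix U assume U: "openin T U"
    show "openin T {x \<in> topspace T. inv x \<in> U}"
      unfolding op P_def
    proof (intro conjI ballI)
      show "{x \<in> topspace T. inv x \<in> U} \<subseteq> carrier G" by (auto simp: top)
      fix x assume "x \<in> {x \<in> topspace T. inv x \<in> U}"
      then have c: "x \<in> carrier G" "inv x \<in> U" by (auto simp: top)
      then obtain N where N: "N \<in> \<B>" "inv x <# N \<subseteq> U" using opE[OF U] by blast
      obtain M where M: "M \<in> \<B>" "\<forall>m\<in>M. x \<otimes> m \<otimes> inv x \<in> N" using conj[OF c(1) N(1)] by auto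
      have "x <# M \<subseteq> {x \<in> topspace T. inv x \<in> U}"
      proof
        fix u assume "u \<in> x <# M"
        then obtain m where m: "m \<in> M" "u = x \<otimes> m" by (auto simp: l_coset_def)
        have mc: "m \<in> carrier G" "inv m \<in> M"
          using m sub[OF M(1)] sg[OF M(1)] by (auto intro: subgroup.m_inv_closed)
        have "inv u = inv x \<otimes> (x \<otimes> inv m \<otimes> inv x)"
          using m mc c by (simp add: inv_mult_group m_assoc[symmetric])
        moreover have "x \<otimes> inv m \<otimes> inv x \<in> N" using M mc by auto
        ultimately have "inv u \<in> U" using N by (auto simp: l_coset_def)
        then show "u \<in> {x \<in> topspace T. inv x \<in> U}" using m mc c by (simp add: top)
      qed
      then show "\<exists>N\<in>\<B>. x <# N \<subseteq> {x \<in> topspace T. inv x \<in> U}" using M by blast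
    qed
  qed
  ultimately have "topological_group G T"
    by (simp add: topological_group_def top is_group)
  moreover have "neighbourhood_basis T \<one> \<B>"
    unfolding neighbourhood_basis_def
  proof (intro conjI ballI allI impI)
    fix N assume N: "N \<in> \<B>"
    have "\<one> <# N = N" using sub[OF N] by (simp add: lcos_mult_one)
    then have "openin T N" using coset_open[of \<one> N] N by simp
    moreover have "\<one> \<in> N" using sg[OF N] by (simp add: subgroup.one_closed)
    ultimately show "neighbourhood_of T \<one> N" using sub[OF N] by (auto simp: neighbourhood_of_def top)
  next
    fix N assume "neighbourhood_of T \<one> N"
    then obtain W where W: "openin T W" "\<one> \<in> W" "W \<subseteq> N" by (auto simp: neighbourhood_of_def)
    then obtain M where M: "M \<in> \<B>" "\<one> <# M \<subseteq> W" using opE by blast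
    have "\<one> <# M = M" using sub[OF M(1)] by (simp add: lcos_mult_one)
    then show "\<exists>M\<in>\<B>. M \<subseteq> N" using M W by auto
  qed
  ultimately show ?thesis by blast
qed

definition left_uniformity :: "('a, 'b) monoid_scheme \<Rightarrow> 'a topology \<Rightarrow> ('a \<times> 'a) set set" where
  "left_uniformity G T =
     {E. E \<subseteq> carrier G \<times> carrier G \<and>
         (\<exists>V. neighbourhood_of T \<one>\<^bsub>G\<^esub> V \<and>
              {(x, y) \<in> carrier G \<times> carrier G. inv\<^bsub>G\<^esub> x \<otimes>\<^bsub>G\<^esub> y \<in> V} \<subseteq> E)}"

definition right_uniformity :: "('a, 'b) monoid_scheme \<Rightarrow> 'a topology \<Rightarrow> ('a \<times> 'a) set set" where
  "right_uniformity G T =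
     {E. E \<subseteq> carrier G \<times> carrier G \<and>
         (\<exists>V. neighbourhood_of T \<one>\<^bsub>G\<^esub> V \<and>
              {(x, y) \<in> carrier G \<times> carrier G. x \<otimes>\<^bsub>G\<^esub> inv\<^bsub>G\<^esub> y \<in> V} \<subseteq> E)}"

definition coset_map :: "('a, 'b) monoid_scheme \<Rightarrow> 'a set \<Rightarrow> 'a \<Rightarrow> 'a set" where
  "coset_map G H g = g <#\<^bsub>G\<^esub> H"

definition left_uniformity_cosets ::
    "('a, 'b) monoid_scheme \<Rightarrow> 'a topology \<Rightarrow> 'a set \<Rightarrow> ('a set \<times> 'a set) set set" where
  "left_uniformity_cosets G T H =
     final_uniformity (carrier G) (left_uniformity G T) (lcosets\<^bsub>G\<^esub> H) (coset_map G H)"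

definition right_uniformity_cosets ::
    "('a, 'b) monoid_scheme \<Rightarrow> 'a topology \<Rightarrow> 'a set \<Rightarrow> ('a set \<times> 'a set) set set" where
  "right_uniformity_cosets G T H =
     final_uniformity (carrier G) (right_uniformity G T) (lcosets\<^bsub>G\<^esub> H) (coset_map G H)"

definition quotient_topology :: "'a topology \<Rightarrow> ('a \<Rightarrow> 'b) \<Rightarrow> 'b topology" where
  "quotient_topology T f =
     topology (\<lambda>W. W \<subseteq> f ` topspace T \<and> openin T {x \<in> topspace T. f x \<in> W})"

lemma openin_quotient_topology:
  "openin (quotient_topology T f) W \<longleftrightarrow>
     W \<subseteq> f ` topspace T \<and> openin T {x \<in> topspace T. f x \<in> W}"
proof -
  have "istopology (\<lambda>W. W \<subseteq> f ` topspace T \<and> openin T {x \<in> topspace T. f x \<in> W})"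
    unfolding istopology_def
  proof (intro conjI allI impI)
    fix V W
    assume "V \<subseteq> f ` topspace T \<and> openin T {x \<in> topspace T. f x \<in> V}"
      and "W \<subseteq> f ` topspace T \<and> openin T {x \<in> topspace T. f x \<in> W}"
    moreover have "{x \<in> topspace T. f x \<in> V \<inter> W} =
        {x \<in> topspace T. f x \<in> V} \<inter> {x \<in> topspace T. f x \<in> W}" by auto
    ultimately show "V \<inter> W \<subseteq> f ` topspace T" "openin T {x \<in> topspace T. f x \<in> V \<inter> W}"
      by auto
  next
    fix \<K> assume K: "\<forall>K\<in>\<K>. K \<subseteq> f ` topspace T \<and> openin T {x \<in> topspace T. f x \<in> K}"
    then show "\<Union>\<K> \<subseteq> f ` topspace T" by blast
    have "{x \<in> topspace T. f x \<in> \<Union>\<K>} = (\<Union>K\<in>\<K>. {x \<in> topspace T. f x \<in> K})" by auto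
    then show "openin T {x \<in> topspace T. f x \<in> \<Union>\<K>}" using K by auto
  qed
  then show ?thesis by (simp add: quotient_topology_def topology_inverse')
qed

lemma quotient_map_quotient_topology: "quotient_map T (quotient_topology T f) f"
proof -
  have "openin (quotient_topology T f) (f ` topspace T)"
  proof -
    have "{x \<in> topspace T. f x \<in> f ` topspace T} = topspace T" by auto
    then show ?thesis by (simp add: openin_quotient_topology)
  qed
  then have "topspace (quotient_topology T f) = f ` topspace T"
    by (metis openin_quotient_topology openin_subset openin_topspace subset_antisym)
  then show ?thesis
    by (auto simp: quotient_map_def openin_quotient_topology)
qed

section \<open>The topology \<open>\<tau>\<^sub>\<cc>\<close> on the symmetric group\<close>

text \<open>The symmetric group of \<open>X\<close> is \<open>BijGroup X\<close>, whose elements are extensional, so functions that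
  agree on \<open>X\<close> are identified. The continuum is represented by \<open>UNIV :: nat set set\<close>.\<close>

definition stab_partition :: "'a set \<Rightarrow> 'a set set \<Rightarrow> ('a \<Rightarrow> 'a) set" where
  "stab_partition X \<gamma> = {f \<in> carrier (BijGroup X). \<forall>B\<in>\<gamma>. f ` B = B}"

definition stab_point :: "'a set \<Rightarrow> 'a \<Rightarrow> ('a \<Rightarrow> 'a) set" where
  "stab_point X a = {f \<in> carrier (BijGroup X). f a = a}"

definition cont_stabs :: "'a set \<Rightarrow> ('a \<Rightarrow> 'a) set set" where
  "cont_stabs X = {stab_partition X \<gamma> | \<gamma>. partition_on X \<gamma> \<and> \<gamma> \<lesssim> (UNIV :: nat set set)}"

definition tau_cont :: "'a set \<Rightarrow> ('a \<Rightarrow> 'a) topology" where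
  "tau_cont X = (THE T. topological_group (BijGroup X) T \<and>
      neighbourhood_basis T \<one>\<^bsub>BijGroup X\<^esub> (cont_stabs X))"

lemma subgroup_stab_partition:
  assumes "partition_on X \<gamma>"
  shows "subgroup (stab_partition X \<gamma>) (BijGroup X)"
proof -
  interpret group "BijGroup X" by (rule group_BijGroup)
  have BX: "B \<subseteq> X" if "B \<in> \<gamma>" for B using assms that by (auto simp: partition_on_def)
  show ?thesis
  proof (rule subgroupI)
    show "stab_partition X \<gamma> \<subseteq> carrier (BijGroup X)" by (auto simp: stab_partition_def)
    have "(\<lambda>x\<in>X. x) ` B = B" if "B \<in> \<gamma>" for B using BX[OF that] by force
    then have "(\<lambda>x\<in>X. x) \<in> stab_partition X \<gamma>"
      by (simp add: stab_partition_def BijGroup_def id_Bij)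
    then show "stab_partition X \<gamma> \<noteq> {}" by blast
  next
    fix f assume f: "f \<in> stab_partition X \<gamma>"
    then have fB: "f \<in> Bij X" by (simp add: stab_partition_def BijGroup_def)
    have "(\<lambda>x\<in>X. inv_into X f x) ` B = B" if B: "B \<in> \<gamma>" for B
    proof -
      have "(\<lambda>x\<in>X. inv_into X f x) ` B = inv_into X f ` B" using BX[OF B] by (intro image_cong) auto
      also have "\<dots> = inv_into X f ` (f ` B)" using f B by (simp add: stab_partition_def)
      also have "\<dots> = B"
        using fB BX[OF B] by (simp add: Bij_def bij_betw_def inv_into_image_cancel)
      finally show ?thesis .
    qed
    then show "inv\<^bsub>BijGroup X\<^esub> f \<in> stab_partition X \<gamma>"
      using fB unfolding inv_BijGroup[OF fB] by (simp add: stab_partition_def BijGroup_def restrict_inv_into_Bij del: image_restrict_eq)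
  next
    fix f g assume fg: "f \<in> stab_partition X \<gamma>" "g \<in> stab_partition X \<gamma>"
    have "compose X f g ` B = B" if B: "B \<in> \<gamma>" for B
    proof -
      have "compose X f g ` B = f ` (g ` B)"
        using BX[OF B] by (auto simp: compose_def image_def)
      then show ?thesis using fg B by (simp add: stab_partition_def)
    qed
    then show "f \<otimes>\<^bsub>BijGroup X\<^esub> g \<in> stab_partition X \<gamma>"
      using fg by (simp add: stab_partition_def BijGroup_def compose_Bij)
  qed
qed

lemma tau_cont_properties:
  "topological_group (BijGroup X) (tau_cont X)"
  "neighbourhood_basis (tau_cont X) \<one>\<^bsub>BijGroup X\<^esub> (cont_stabs X)"
proof -
  interpret group "BijGroup X" by (rule group_BijGroup)
  have "\<exists>T. topological_group (BijGroup X) T \<and> neighbourhood_basis T \<one>\<^bsub>BijGroup X\<^esub> (cont_stabs X)"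
  proof (rule topological_group_from_subgroups)
    have "partition_on X ({X} - {{}})" by (auto simp: partition_on_def pairwise_def)
    moreover have "{X} - {{}} \<lesssim> (UNIV :: nat set set)"
      by (rule lepoll_trans[of _ "{{} :: nat set}"])
        (auto simp: lepoll_def inj_on_def subset_imp_lepoll intro!: exI[of _ "\<lambda>_. {}"])
    ultimately show "cont_stabs X \<noteq> {}" unfolding cont_stabs_def by blast
  next
    fix N assume "N \<in> cont_stabs X"
    then show "subgroup N (BijGroup X)" by (auto simp: cont_stabs_def subgroup_stab_partition)
  next
    fix M N assume "M \<in> cont_stabs X" "N \<in> cont_stabs X"
    then obtain \<gamma> \<delta> where g: "partition_on X \<gamma>" "\<gamma> \<lesssim> (UNIV :: nat set set)" "M = stab_partition X \<gamma>"
      and d: "partition_on X \<delta>" "\<delta> \<lesssim> (UNIV :: nat set set)" "N = stab_partition X \<delta>"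
      by (auto simp: cont_stabs_def)
    define \<epsilon> where "\<epsilon> = (\<lambda>(A, B). A \<inter> B) ` (\<gamma> \<times> \<delta>) - {{}}"
    have "partition_on X \<epsilon>"
    proof (rule partition_onI)
      have "\<Union>\<epsilon> = \<Union>\<gamma> \<inter> \<Union>\<delta>" unfolding \<epsilon>_def by auto
      then show "\<Union>\<epsilon> = X" using g(1) d(1) by (simp add: partition_on_def)
      show "{} \<notin> \<epsilon>" by (simp add: \<epsilon>_def)
      have *: "A = A'" if "A \<in> \<gamma>" "A' \<in> \<gamma>" "x \<in> A" "x \<in> A'" for A A' x
        using g(1) that by (auto simp: partition_on_def pairwise_def disjnt_def)
      have **: "A = A'" if "A \<in> \<delta>" "A' \<in> \<delta>" "x \<in> A" "x \<in> A'" for A A' x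
        using d(1) that by (auto simp: partition_on_def pairwise_def disjnt_def)
      fix p q assume pq: "p \<in> \<epsilon>" "q \<in> \<epsilon>" "p \<noteq> q"
      then obtain A B A' B' where "p = A \<inter> B" "q = A' \<inter> B'" "A \<in> \<gamma>" "A' \<in> \<gamma>" "B \<in> \<delta>" "B' \<in> \<delta>"
        by (auto simp: \<epsilon>_def)
      then show "disjnt p q" using *[of A A'] **[of B B'] pq(3) by (auto simp: disjnt_def)
    qed
    moreover have "\<epsilon> \<lesssim> (UNIV :: nat set set)"
    proof -
      have "\<epsilon> \<lesssim> (\<lambda>(A, B). A \<inter> B) ` (\<gamma> \<times> \<delta>)" unfolding \<epsilon>_def by (rule subset_imp_lepoll) auto
      also have "\<dots> \<lesssim> \<gamma> \<times> \<delta>" by (rule image_lepoll)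
      also have "\<dots> \<lesssim> (UNIV :: nat set set) \<times> (UNIV :: nat set set)"
        using g(2) d(2) by (rule times_lepoll_mono)
      also have "\<dots> \<approx> (UNIV :: nat set set)"
        unfolding eqpoll_iff_card_of_ordIso
        by (rule card_of_Times_same_infinite) (simp add: Finite_Set.finite_set)
      finally show ?thesis .
    qed
    moreover have "stab_partition X \<epsilon> \<subseteq> M \<inter> N"
    proof -
      have "f ` A = A" if f: "f \<in> stab_partition X \<epsilon>" and A: "A \<in> \<gamma> \<or> A \<in> \<delta>" for f A
      proof -
        have "A = \<Union>{E \<in> \<epsilon>. E \<subseteq> A}"
        proof
          show "A \<subseteq> \<Union>{E \<in> \<epsilon>. E \<subseteq> A}"
          proof
            fix x assume x: "x \<in> A"
            then have "x \<in> \<Union>\<gamma>" "x \<in> \<Union>\<delta>" using A g(1) d(1) by (auto simp: partition_on_def)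
            then obtain C D where "C \<in> \<gamma>" "x \<in> C" "D \<in> \<delta>" "x \<in> D" by blast
            then show "x \<in> \<Union>{E \<in> \<epsilon>. E \<subseteq> A}"
            proof (cases "A \<in> \<gamma>")
              case True
              then have "A \<inter> D \<in> \<epsilon>" using \<open>D \<in> \<delta>\<close> \<open>x \<in> D\<close> x by (auto simp: \<epsilon>_def)
              then show ?thesis using x \<open>x \<in> D\<close> by blast
            next
              case False
              then have "C \<inter> A \<in> \<epsilon>" using A \<open>C \<in> \<gamma>\<close> \<open>x \<in> C\<close> x by (auto simp: \<epsilon>_def)
              then show ?thesis using x \<open>x \<in> C\<close> by blast
            qed
          qed
        qed auto
        moreover have "f ` \<Union>{E \<in> \<epsilon>. E \<subseteq> A} = \<Union>{E \<in> \<epsilon>. E \<subseteq> A}"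
          unfolding image_Union using f by (auto simp: stab_partition_def)
        ultimately show ?thesis by simp
      qed
      then show ?thesis using g(3) d(3) by (auto simp: stab_partition_def)
    qed
    ultimately show "\<exists>K\<in>cont_stabs X. K \<subseteq> M \<inter> N" unfolding cont_stabs_def by blast
  next
    fix g N assume g: "g \<in> carrier (BijGroup X)" and "N \<in> cont_stabs X"
    then obtain \<gamma> where c: "partition_on X \<gamma>" "\<gamma> \<lesssim> (UNIV :: nat set set)" "N = stab_partition X \<gamma>"
      by (auto simp: cont_stabs_def)
    have gB: "g \<in> Bij X" using g by (simp add: BijGroup_def)
    then have bij: "bij_betw g X X" by (simp add: Bij_def)
    define h where "h = inv\<^bsub>BijGroup X\<^esub> g"
    have hc: "h \<in> carrier (BijGroup X)" using g by (simp add: h_def)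
    have hB: "h \<in> Bij X" using hc by (simp add: BijGroup_def)
    then have hbij: "bij_betw h X X" by (simp add: Bij_def)
    have h_eq: "h x = inv_into X g x" if "x \<in> X" for x using that gB by (simp add: h_def inv_BijGroup)
    have gh: "g (h x) = x" if "x \<in> X" for x
      using bij that by (simp add: h_eq bij_betw_def f_inv_into_f)
    have BX: "B \<subseteq> X" if "B \<in> \<gamma>" for B using c(1) that by (auto simp: partition_on_def)
    have part: "partition_on X ((`) h ` \<gamma>)"
    proof (rule partition_onI)
      have "\<Union>((`) h ` \<gamma>) = h ` \<Union>\<gamma>" by auto
      then show "\<Union>((`) h ` \<gamma>) = X" using c(1) hbij by (simp add: partition_on_def bij_betw_def)
      show "{} \<notin> (`) h ` \<gamma>" using c(1) by (auto simp: partition_on_def)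
      fix p q assume pq: "p \<in> (`) h ` \<gamma>" "q \<in> (`) h ` \<gamma>" "p \<noteq> q"
      then obtain A B where AB: "A \<in> \<gamma>" "B \<in> \<gamma>" "p = h ` A" "q = h ` B" by auto
      then have "A \<inter> B = {}" using c(1) pq(3)
        by (auto simp: partition_on_def pairwise_def disjnt_def)
      then have "h ` A \<inter> h ` B = {}"
        using hbij BX[OF AB(1)] BX[OF AB(2)] by (auto simp: bij_betw_def dest: inj_onD)
      then show "disjnt p q" using AB by (simp add: disjnt_def)
    qed
    moreover have "(`) h ` \<gamma> \<lesssim> (UNIV :: nat set set)"
      using image_lepoll c(2) lepoll_trans by blast
    ultimately have mem: "stab_partition X ((`) h ` \<gamma>) \<in> cont_stabs X"
      unfolding cont_stabs_def by blast
    have "g \<otimes>\<^bsub>BijGroup X\<^esub> m \<otimes>\<^bsub>BijGroup X\<^esub> h \<in> N" if m: "m \<in> stab_partition X ((`) h ` \<gamma>)" for m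
    proof -
      have mc: "m \<in> carrier (BijGroup X)" using m by (simp add: stab_partition_def)
      then have mB: "m \<in> Bij X" by (simp add: BijGroup_def)
      have "(g \<otimes>\<^bsub>BijGroup X\<^esub> m \<otimes>\<^bsub>BijGroup X\<^esub> h) ` B = B" if B: "B \<in> \<gamma>" for B
      proof -
        have "(g \<otimes>\<^bsub>BijGroup X\<^esub> m \<otimes>\<^bsub>BijGroup X\<^esub> h) ` B = (\<lambda>x. g (m (h x))) ` B"
        proof (rule image_cong)
          fix x assume "x \<in> B"
          then have x: "x \<in> X" using BX[OF B] by auto
          then have "h x \<in> X" using hbij by (auto simp: bij_betw_def)
          then show "(g \<otimes>\<^bsub>BijGroup X\<^esub> m \<otimes>\<^bsub>BijGroup X\<^esub> h) x = g (m (h x))"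
            using gB mB hB x by (simp add: BijGroup_def compose_Bij compose_eq)
        qed simp
        also have "\<dots> = g ` (m ` (h ` B))" by (simp add: image_image)
        also have "\<dots> = g ` (h ` B)" using m B by (simp add: stab_partition_def)
        also have "\<dots> = (\<lambda>x. x) ` B"
          unfolding image_image using gh BX[OF B] by (intro image_cong) auto
        finally show ?thesis by simp
      qed
      then show ?thesis using c(3) g mc hc by (simp add: stab_partition_def)
    qed
    then show "\<exists>M\<in>cont_stabs X. \<forall>m\<in>M. g \<otimes>\<^bsub>BijGroup X\<^esub> m \<otimes>\<^bsub>BijGroup X\<^esub> inv\<^bsub>BijGroup X\<^esub> g \<in> N"
      using mem unfolding h_def by blast
  qed
  then have "\<exists>!T. topological_group (BijGroup X) T \<and>
      neighbourhood_basis T \<one>\<^bsub>BijGroup X\<^esub> (cont_stabs X)"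
    using topological_group_unique by blast
  from theI'[OF this] show "topological_group (BijGroup X) (tau_cont X)"
    "neighbourhood_basis (tau_cont X) \<one>\<^bsub>BijGroup X\<^esub> (cont_stabs X)"
    by (simp_all add: tau_cont_def)
qed

end

theory Submission
  imports Defs
begin

text \<open>
  The point stabiliser \<open>H\<close> is the stabiliser of the partition of \<open>X\<close> into \<open>{a}\<close> and its complement,
  so it is open. For an open subgroup \<open>H\<close> of any topological group the quotient topology is
  discrete, and so are the topologies of both uniformities on the coset space: separating a single
  coset \<open>p = gH\<close> from its complement is an equivalence relation on the coset space whose preimage
  in \<open>G\<close> is an entourage, witnessed by the neighbourhood \<open>H\<close> on the left and by its conjugate
  \<open>gHg\<inverse>\<close> on the right. The single relations suffice because the final uniformity
  contains every uniformity that makes the quotient map uniformly continuous.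
\<close>

section \<open>Final uniformities\<close>

text \<open>An equivalence relation is symmetric and satisfies \<open>R O R \<subseteq> R\<close>,
  so it serves as its own half-size entourage and its supersets form a uniformity. These are the
  explicit uniformities that get compared with the final one.\<close>

lemma uniformity_on_principal:
  assumes "equiv S R"
  shows "uniformity_on S {E. R \<subseteq> E \<and> E \<subseteq> S \<times> S}"
proof -
  have R: "R \<subseteq> S \<times> S" "Id_on S \<subseteq> R" "R\<inverse> = R" "R O R \<subseteq> R"
    using assms by (auto simp: equiv_def refl_on_def sym_conv_converse_eq trans_O_subset)
  show ?thesis
    unfolding uniformity_on_def
  proof (intro conjI ballI allI impI)
    fix E assume E: "E \<in> {E. R \<subseteq> E \<and> E \<subseteq> S \<times> S}"
    have "R\<inverse> \<subseteq> E\<inverse>" "E\<inverse> \<subseteq> (S \<times> S)\<inverse>" using E by auto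
    then show "E\<inverse> \<in> {E. R \<subseteq> E \<and> E \<subseteq> S \<times> S}" using R(3) by (simp add: converse_Times)
    show "\<exists>D\<in>{E. R \<subseteq> E \<and> E \<subseteq> S \<times> S}. D O D \<subseteq> E"
      using R(1,4) E by (intro bexI[of _ R]) (simp_all add: subset_trans[of "R O R" R E])
  qed (use R(1,2) in \<open>simp_all, blast+\<close>)
qed

text \<open>Only the maximality of the final uniformity is used, with one comparison uniformity per
  point. Asking instead that the kernel of \<open>f\<close> be an entourage would be too strong for
  the right uniformity: it would require a neighbourhood of the identity inside every conjugate of
  \<open>H\<close>.\<close>

lemma uniform_topology_final_uniformity_eq_discrete:
  assumes U: "uniformity_on S \<U>" and f: "f ` S \<subseteq> S'"
    and sep: "\<And>p. p \<in> S' \<Longrightarrow> {(x, y) \<in> S \<times> S. f x = p \<longleftrightarrow> f y = p} \<in> \<U>"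
  shows "uniform_topology S' (final_uniformity S \<U> S' f) = discrete_topology S'"
proof -
  let ?F = "final_uniformity S \<U> S' f"
  have final: "is_final_uniformity S \<U> S' f ?F"
    using U f by (rule is_final_uniformity_final_uniformity)
  have "\<exists>E\<in>?F. E `` {p} \<subseteq> {p}" if p: "p \<in> S'" for p
  proof -
    \<comment> \<open>The classes are \<open>{p}\<close> and its complement in \<open>S'\<close>.
      Hence \<open>R\<close> isolates \<open>p\<close>, and its preimage under \<open>f\<close> is
      the entourage given by \<open>sep\<close>.\<close>
    define R where "R = {(u, v) \<in> S' \<times> S'. u = p \<longleftrightarrow> v = p}"
    define \<W> where "\<W> = {E. R \<subseteq> E \<and> E \<subseteq> S' \<times> S'}"
    have "equiv S' R"
      by (auto simp: R_def intro!: equivI refl_onI symI transI)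
    then have "uniformity_on S' \<W>"
      unfolding \<W>_def by (rule uniformity_on_principal)
    moreover have "uniformly_continuous_wrt S \<U> \<W> f"
      unfolding uniformly_continuous_wrt_def
    proof
      fix E assume "E \<in> \<W>"
      then have "{(x, y) \<in> S \<times> S. f x = p \<longleftrightarrow> f y = p} \<subseteq> {(x, y) \<in> S \<times> S. (f x, f y) \<in> E}"
        using f unfolding \<W>_def R_def by blast
      moreover have "{(x, y) \<in> S \<times> S. (f x, f y) \<in> E} \<subseteq> S \<times> S" by auto
      ultimately show "{(x, y) \<in> S \<times> S. (f x, f y) \<in> E} \<in> \<U>"
        using U sep[OF p] unfolding uniformity_on_def by meson
    qed
    ultimately have "\<W> \<subseteq> ?F"
      using final by (simp add: is_final_uniformity_def)
    moreover have "R \<in> \<W>" by (auto simp: \<W>_def R_def)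
    moreover have "R `` {p} \<subseteq> {p}" by (auto simp: R_def)
    ultimately show ?thesis by blast
  qed
  \<comment> \<open>An entourage isolating \<open>p\<close> works for every \<open>W\<close>
    containing \<open>p\<close>. It may vary with \<open>p\<close>, since openness is tested point
    by point.\<close>
  then have "\<exists>E\<in>?F. E `` {p} \<subseteq> W" if "W \<subseteq> S'" "p \<in> W" for W p
    using that by (meson empty_subsetI insert_subset subset_iff subset_trans)
  moreover have "uniformity_on S' ?F" using final by (simp add: is_final_uniformity_def)
  ultimately have "openin (uniform_topology S' ?F) W \<longleftrightarrow> W \<subseteq> S'" for W
    by (metis openin_uniform_topology)
  then show ?thesis by (simp add: topology_eq)
qed

section \<open>The two uniformities of a topological group\<close>

lemma topological_group_continuous_mult:
  assumes "topological_group G T" "continuous_map T T f" "continuous_map T T g"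
  shows "continuous_map T T (\<lambda>x. f x \<otimes>\<^bsub>G\<^esub> g x)"
proof -
  have "continuous_map T (prod_topology T T) (\<lambda>x. (f x, g x))"
    using assms by (intro continuous_map_pairedI)
  then show ?thesis
    using assms(1) continuous_map_compose by (fastforce simp: topological_group_def o_def)
qed

lemma neighbourhood_of_Int:
  "neighbourhood_of T x V \<Longrightarrow> neighbourhood_of T x W \<Longrightarrow> neighbourhood_of T x (V \<inter> W)"
  unfolding neighbourhood_of_def by (blast intro: openin_Int)

lemma topological_group_neighbourhood_inv:
  assumes G: "topological_group G T" and V: "neighbourhood_of T \<one>\<^bsub>G\<^esub> V"
  shows "neighbourhood_of T \<one>\<^bsub>G\<^esub> {x \<in> carrier G. inv\<^bsub>G\<^esub> x \<in> V}"
proof -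
  interpret group G using G by (simp add: topological_group_def)
  obtain W where W: "openin T W" "\<one>\<^bsub>G\<^esub> \<in> W" "W \<subseteq> V"
    using V by (auto simp: neighbourhood_of_def)
  have "openin T {x \<in> topspace T. inv\<^bsub>G\<^esub> x \<in> W}"
    using G W(1) by (intro openin_continuous_map_preimage) (auto simp: topological_group_def)
  then show ?thesis
    using G W unfolding neighbourhood_of_def topological_group_def
    by (intro conjI exI[of _ "{x \<in> topspace T. inv\<^bsub>G\<^esub> x \<in> W}"]) auto
qed

text \<open>Continuity of multiplication at the pair of identities gives an open box
  \<open>A \<times> B\<close> mapped into \<open>V\<close>; intersecting its two sides makes one
  neighbourhood serve both factors.\<close>

lemma topological_group_neighbourhood_mult:
  assumes G: "topological_group G T" and V: "neighbourhood_of T \<one>\<^bsub>G\<^esub> V"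
  obtains W where "neighbourhood_of T \<one>\<^bsub>G\<^esub> W" "\<And>x y. x \<in> W \<Longrightarrow> y \<in> W \<Longrightarrow> x \<otimes>\<^bsub>G\<^esub> y \<in> V"
proof -
  interpret group G using G by (simp add: topological_group_def)
  have top: "topspace T = carrier G" using G by (simp add: topological_group_def)
  obtain U where U: "openin T U" "\<one>\<^bsub>G\<^esub> \<in> U" "U \<subseteq> V"
    using V by (auto simp: neighbourhood_of_def)
  let ?P = "{p \<in> topspace (prod_topology T T). (\<lambda>(x, y). x \<otimes>\<^bsub>G\<^esub> y) p \<in> U}"
  have "openin (prod_topology T T) ?P"
    using G U(1) by (intro openin_continuous_map_preimage) (auto simp: topological_group_def)
  moreover have "(\<one>\<^bsub>G\<^esub>, \<one>\<^bsub>G\<^esub>) \<in> ?P" using U(2) by (simp add: top)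
  ultimately obtain A B where AB: "openin T A" "openin T B" "\<one>\<^bsub>G\<^esub> \<in> A" "\<one>\<^bsub>G\<^esub> \<in> B" "A \<times> B \<subseteq> ?P"
    unfolding openin_prod_topology_alt by meson
  have "neighbourhood_of T \<one>\<^bsub>G\<^esub> (A \<inter> B)"
    using AB openin_subset unfolding neighbourhood_of_def by blast
  moreover have "x \<otimes>\<^bsub>G\<^esub> y \<in> V" if "x \<in> A \<inter> B" "y \<in> A \<inter> B" for x y
    using AB(5) U(3) that by auto
  ultimately show thesis by (rule that)
qed

text \<open>Both uniformities are instances: \<open>d x y = x\<inverse>y\<close> on the left, \<open>d x y = xy\<inverse>\<close> on the right.\<close>

lemma uniformity_on_group_difference:
  assumes G: "topological_group G T"
    and refl: "\<And>x. x \<in> carrier G \<Longrightarrow> d x x = \<one>\<^bsub>G\<^esub>"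
    and sym: "\<And>x y. x \<in> carrier G \<Longrightarrow> y \<in> carrier G \<Longrightarrow> d y x = inv\<^bsub>G\<^esub> (d x y)"
    and trans: "\<And>x y z. x \<in> carrier G \<Longrightarrow> y \<in> carrier G \<Longrightarrow> z \<in> carrier G \<Longrightarrow>
        d x z = d x y \<otimes>\<^bsub>G\<^esub> d y z"
    and closed: "\<And>x y. x \<in> carrier G \<Longrightarrow> y \<in> carrier G \<Longrightarrow> d x y \<in> carrier G"
  shows "uniformity_on (carrier G)
     {E. E \<subseteq> carrier G \<times> carrier G \<and>
         (\<exists>V. neighbourhood_of T \<one>\<^bsub>G\<^esub> V \<and> {(x, y) \<in> carrier G \<times> carrier G. d x y \<in> V} \<subseteq> E)}"
    (is "uniformity_on _ ?\<U>")
proof -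
  interpret group G using G by (simp add: topological_group_def)
  have top: "topspace T = carrier G" using G by (simp add: topological_group_def)
  define ent where "ent V = {(x, y) \<in> carrier G \<times> carrier G. d x y \<in> V}" for V
  have U: "E \<in> ?\<U> \<longleftrightarrow> E \<subseteq> carrier G \<times> carrier G \<and> (\<exists>V. neighbourhood_of T \<one>\<^bsub>G\<^esub> V \<and> ent V \<subseteq> E)" for E
    by (simp add: ent_def)
  have entU: "ent V \<in> ?\<U>" if "neighbourhood_of T \<one>\<^bsub>G\<^esub> V" for V
    unfolding U using that by (auto simp: ent_def)
  show ?thesis
    unfolding uniformity_on_def
  proof (intro conjI ballI allI impI)
    have "neighbourhood_of T \<one>\<^bsub>G\<^esub> (carrier G)"
      unfolding neighbourhood_of_def using openin_topspace[of T] top by auto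
    then show "carrier G \<times> carrier G \<in> ?\<U>"
      unfolding U by (auto simp: ent_def)
  next
    fix E assume "E \<in> ?\<U>"
    then obtain V where E: "E \<subseteq> carrier G \<times> carrier G"
      and V: "neighbourhood_of T \<one>\<^bsub>G\<^esub> V" "ent V \<subseteq> E"
      unfolding U by blast
    show "E \<subseteq> carrier G \<times> carrier G" by (rule E)
    have "\<one>\<^bsub>G\<^esub> \<in> V" using V(1) by (auto simp: neighbourhood_of_def)
    then have "Id_on (carrier G) \<subseteq> ent V" by (auto simp: ent_def refl)
    then show "Id_on (carrier G) \<subseteq> E" using V(2) by (rule subset_trans)
    show "E' \<in> ?\<U>" if "E \<subseteq> E' \<and> E' \<subseteq> carrier G \<times> carrier G" for E'
      unfolding U using that V by blast
    show "E \<inter> E' \<in> ?\<U>" if E': "E' \<in> ?\<U>" for E'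
    proof -
      obtain V' where V': "neighbourhood_of T \<one>\<^bsub>G\<^esub> V'" "ent V' \<subseteq> E'"
        using E' unfolding U by blast
      have "ent (V \<inter> V') \<subseteq> E \<inter> E'" using V(2) V'(2) by (auto simp: ent_def)
      then show ?thesis
        unfolding U using E neighbourhood_of_Int[OF V(1) V'(1)]
        by (intro conjI exI[of _ "V \<inter> V'"]) auto
    qed
    \<comment> \<open>Swapping the arguments of \<open>d\<close> inverts its value, so the converse
      of an entourage is governed by the inverted neighbourhood.\<close>
    have "ent {x \<in> carrier G. inv\<^bsub>G\<^esub> x \<in> V} \<subseteq> E\<inverse>"
    proof (rule subrelI)
      fix x y assume "(x, y) \<in> ent {x \<in> carrier G. inv\<^bsub>G\<^esub> x \<in> V}"
      then have "(y, x) \<in> ent V" using sym[of x y] by (simp add: ent_def)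
      then show "(x, y) \<in> E\<inverse>" using V(2) by blast
    qed
    then show "E\<inverse> \<in> ?\<U>"
      unfolding U using E topological_group_neighbourhood_inv[OF G V(1)]
      by (intro conjI exI[of _ "{x \<in> carrier G. inv\<^bsub>G\<^esub> x \<in> V}"]) auto
    obtain W where W: "neighbourhood_of T \<one>\<^bsub>G\<^esub> W" "\<And>x y. x \<in> W \<Longrightarrow> y \<in> W \<Longrightarrow> x \<otimes>\<^bsub>G\<^esub> y \<in> V"
      by (rule topological_group_neighbourhood_mult[OF G V(1)]) blast
    \<comment> \<open>The chain rule \<open>trans\<close> turns composition of relations into
      multiplication of differences, so a \<open>W\<close> whose products lie in \<open>V\<close>
      gives the half-size entourage.\<close>
    have "ent W O ent W \<subseteq> ent V"
    proof (rule subrelI)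
      fix x z assume "(x, z) \<in> ent W O ent W"
      then obtain y where "(x, y) \<in> ent W" "(y, z) \<in> ent W" by blast
      then show "(x, z) \<in> ent V" using W(2) trans[of x y z] by (simp add: ent_def)
    qed
    then have "ent W O ent W \<subseteq> E" using V(2) by (rule subset_trans)
    then show "\<exists>D\<in>?\<U>. D O D \<subseteq> E" using entU[OF W(1)] by blast
  qed
qed

lemma uniformity_on_left_uniformity:
  assumes "topological_group G T"
  shows "uniformity_on (carrier G) (left_uniformity G T)"
proof -
  interpret group G using assms by (simp add: topological_group_def)
  show ?thesis
    unfolding left_uniformity_def
  proof (rule uniformity_on_group_difference[OF assms])
    fix x y z assume c: "x \<in> carrier G" "y \<in> carrier G" "z \<in> carrier G"
    \<comment> \<open>Once all brackets are moved to the right, this cancellation is all that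
      remains of the chain rule.\<close>
    have "y \<otimes>\<^bsub>G\<^esub> (inv\<^bsub>G\<^esub> y \<otimes>\<^bsub>G\<^esub> z) = z" using c by (simp add: m_assoc[symmetric])
    then show "inv\<^bsub>G\<^esub> x \<otimes>\<^bsub>G\<^esub> z = inv\<^bsub>G\<^esub> x \<otimes>\<^bsub>G\<^esub> y \<otimes>\<^bsub>G\<^esub> (inv\<^bsub>G\<^esub> y \<otimes>\<^bsub>G\<^esub> z)"
      using c by (simp add: m_assoc)
  qed (auto simp: inv_mult_group)
qed

lemma uniformity_on_right_uniformity:
  assumes "topological_group G T"
  shows "uniformity_on (carrier G) (right_uniformity G T)"
proof -
  interpret group G using assms by (simp add: topological_group_def)
  show ?thesis
    unfolding right_uniformity_def
  proof (rule uniformity_on_group_difference[OF assms])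
    fix x y z assume c: "x \<in> carrier G" "y \<in> carrier G" "z \<in> carrier G"
    have "inv\<^bsub>G\<^esub> y \<otimes>\<^bsub>G\<^esub> (y \<otimes>\<^bsub>G\<^esub> inv\<^bsub>G\<^esub> z) = inv\<^bsub>G\<^esub> z" using c by (simp add: m_assoc[symmetric])
    then show "x \<otimes>\<^bsub>G\<^esub> inv\<^bsub>G\<^esub> z = x \<otimes>\<^bsub>G\<^esub> inv\<^bsub>G\<^esub> y \<otimes>\<^bsub>G\<^esub> (y \<otimes>\<^bsub>G\<^esub> inv\<^bsub>G\<^esub> z)"
      using c by (simp add: m_assoc)
  qed (auto simp: inv_mult_group)
qed

section \<open>Quotients by open subgroups\<close>

lemma coset_map_image: "coset_map G H ` carrier G = lcosets\<^bsub>G\<^esub> H"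
  by (auto simp: coset_map_def LCOSETS_def)

lemma (in group) coset_map_eq_iff:
  assumes H: "subgroup H G" and c: "x \<in> carrier G" "y \<in> carrier G"
  shows "coset_map G H x = coset_map G H y \<longleftrightarrow> inv x \<otimes> y \<in> H"
proof
  assume "coset_map G H x = coset_map G H y"
  then have "y \<in> x <# H" using lcos_self[OF c(2) H] by (simp add: coset_map_def)
  then obtain h where "h \<in> H" "y = x \<otimes> h" by (auto simp: l_coset_def)
  then show "inv x \<otimes> y \<in> H"
    using c(1) subgroup.mem_carrier[OF H] by (simp add: m_assoc[symmetric])
next
  assume "inv x \<otimes> y \<in> H"
  moreover have "y = x \<otimes> (inv x \<otimes> y)" using c by (simp add: m_assoc[symmetric])
  ultimately have "y \<in> x <# H" unfolding l_coset_def by blast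
  then show "coset_map G H x = coset_map G H y"
    unfolding coset_map_def using c(1) H by (rule l_repr_independence)
qed

text \<open>The entourage of the neighbourhood \<open>H\<close> is exactly the relation of lying in
  the same left coset, so it is contained in the separating relation of every \<open>p\<close> at
  once.\<close>

lemma left_uniformity_cosets_discrete:
  assumes G: "topological_group G T" and H: "subgroup H G" "openin T H"
  shows "uniform_topology (lcosets\<^bsub>G\<^esub> H) (left_uniformity_cosets G T H) = discrete_topology (lcosets\<^bsub>G\<^esub> H)"
  unfolding left_uniformity_cosets_def
proof (rule uniform_topology_final_uniformity_eq_discrete)
  interpret group G using G by (simp add: topological_group_def)
  show "uniformity_on (carrier G) (left_uniformity G T)"
    using G by (rule uniformity_on_left_uniformity)
  show "coset_map G H ` carrier G \<subseteq> lcosets\<^bsub>G\<^esub> H" by (simp add: coset_map_image)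
  fix p
  have "neighbourhood_of T \<one>\<^bsub>G\<^esub> H"
    unfolding neighbourhood_of_def
    using openin_subset[OF H(2)] H(2) subgroup.one_closed[OF H(1)] by (intro conjI exI[of _ H]) simp_all
  moreover have "{(x, y) \<in> carrier G \<times> carrier G. inv\<^bsub>G\<^esub> x \<otimes>\<^bsub>G\<^esub> y \<in> H}
      \<subseteq> {(x, y) \<in> carrier G \<times> carrier G. coset_map G H x = p \<longleftrightarrow> coset_map G H y = p}"
    using coset_map_eq_iff[OF H(1)] by auto
  ultimately show "{(x, y) \<in> carrier G \<times> carrier G. coset_map G H x = p \<longleftrightarrow> coset_map G H y = p}
      \<in> left_uniformity G T"
    unfolding left_uniformity_def by (intro CollectI conjI exI[of _ H]) auto
qed

text \<open>Right-close points satisfy \<open>x = v y\<close> with \<open>v\<close> near the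
  identity, so their cosets differ by left translation by \<open>v\<close>. If \<open>v\<close> lies
  in the stabiliser of \<open>gH\<close> under this action, the conjugate of \<open>H\<close> by
  \<open>g\<close>, then \<open>xH = gH\<close> exactly when \<open>yH = gH\<close>. The
  neighbourhood therefore depends on the coset being separated.\<close>

lemma right_uniformity_cosets_discrete:
  assumes G: "topological_group G T" and H: "subgroup H G" "openin T H"
  shows "uniform_topology (lcosets\<^bsub>G\<^esub> H) (right_uniformity_cosets G T H) = discrete_topology (lcosets\<^bsub>G\<^esub> H)"
  unfolding right_uniformity_cosets_def
proof (rule uniform_topology_final_uniformity_eq_discrete)
  interpret group G using G by (simp add: topological_group_def)
  have top: "topspace T = carrier G" using G by (simp add: topological_group_def)
  show "uniformity_on (carrier G) (right_uniformity G T)"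
    using G by (rule uniformity_on_right_uniformity)
  show "coset_map G H ` carrier G \<subseteq> lcosets\<^bsub>G\<^esub> H" by (simp add: coset_map_image)
  fix p assume "p \<in> lcosets\<^bsub>G\<^esub> H"
  then obtain g where g: "g \<in> carrier G" "p = coset_map G H g"
    by (auto simp: coset_map_image[symmetric])
  \<comment> \<open>This is the conjugate of \<open>H\<close> by \<open>g\<close>, written as a
    preimage of \<open>H\<close> so that openness follows from continuity of conjugation.\<close>
  define V where "V = {v \<in> carrier G. inv\<^bsub>G\<^esub> g \<otimes>\<^bsub>G\<^esub> v \<otimes>\<^bsub>G\<^esub> g \<in> H}"
  have "continuous_map T T (\<lambda>v. inv\<^bsub>G\<^esub> g \<otimes>\<^bsub>G\<^esub> v \<otimes>\<^bsub>G\<^esub> g)"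
    using g(1) top by (intro topological_group_continuous_mult[OF G]) auto
  from openin_continuous_map_preimage[OF this H(2)] have "openin T V" by (simp add: V_def top)
  moreover have "\<one>\<^bsub>G\<^esub> \<in> V" using g(1) subgroup.one_closed[OF H(1)] by (simp add: V_def)
  ultimately have "neighbourhood_of T \<one>\<^bsub>G\<^esub> V"
    unfolding neighbourhood_of_def using openin_subset[of T V] by (intro conjI exI[of _ V]) simp_all
  moreover have "coset_map G H x = p \<longleftrightarrow> coset_map G H y = p"
    if c: "x \<in> carrier G" "y \<in> carrier G" and v: "x \<otimes>\<^bsub>G\<^esub> inv\<^bsub>G\<^esub> y \<in> V" for x y
  proof -
    let ?h = "inv\<^bsub>G\<^esub> g \<otimes>\<^bsub>G\<^esub> (x \<otimes>\<^bsub>G\<^esub> inv\<^bsub>G\<^esub> y) \<otimes>\<^bsub>G\<^esub> g"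
    have h: "?h \<in> H" using v by (simp add: V_def)
    \<comment> \<open>Membership of \<open>inv g \<otimes> x\<close> in \<open>H\<close> says that
      \<open>x\<close> lies in \<open>p\<close>. The two elements compared differ by the left factor
      \<open>?h\<close> in \<open>H\<close>, so they lie in \<open>H\<close> together.\<close>
    have xy: "inv\<^bsub>G\<^esub> g \<otimes>\<^bsub>G\<^esub> x = ?h \<otimes>\<^bsub>G\<^esub> (inv\<^bsub>G\<^esub> g \<otimes>\<^bsub>G\<^esub> y)"
    proof -
      have "g \<otimes>\<^bsub>G\<^esub> (inv\<^bsub>G\<^esub> g \<otimes>\<^bsub>G\<^esub> y) = y" using c g(1) by (simp add: m_assoc[symmetric])
      then show ?thesis using c g(1) by (simp add: m_assoc)
    qed
    have "inv\<^bsub>G\<^esub> g \<otimes>\<^bsub>G\<^esub> x \<in> H \<longleftrightarrow> inv\<^bsub>G\<^esub> g \<otimes>\<^bsub>G\<^esub> y \<in> H"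
    proof
      assume "inv\<^bsub>G\<^esub> g \<otimes>\<^bsub>G\<^esub> y \<in> H"
      then show "inv\<^bsub>G\<^esub> g \<otimes>\<^bsub>G\<^esub> x \<in> H" unfolding xy by (rule subgroup.m_closed[OF H(1) h])
    next
      assume x: "inv\<^bsub>G\<^esub> g \<otimes>\<^bsub>G\<^esub> x \<in> H"
      have "inv\<^bsub>G\<^esub> g \<otimes>\<^bsub>G\<^esub> y = inv\<^bsub>G\<^esub> ?h \<otimes>\<^bsub>G\<^esub> (inv\<^bsub>G\<^esub> g \<otimes>\<^bsub>G\<^esub> x)"
        using xy c g(1) by (intro inv_solve_left[THEN iffD2]) auto
      then show "inv\<^bsub>G\<^esub> g \<otimes>\<^bsub>G\<^esub> y \<in> H"
        using H(1) h x by (metis subgroup.m_closed subgroup.m_inv_closed)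
    qed
    then show ?thesis
      using coset_map_eq_iff[OF H(1) g(1)] c g(2) by metis
  qed
  ultimately show "{(x, y) \<in> carrier G \<times> carrier G. coset_map G H x = p \<longleftrightarrow> coset_map G H y = p}
      \<in> right_uniformity G T"
    unfolding right_uniformity_def by (intro CollectI conjI exI[of _ V]) auto
qed

text \<open>The fibres of the coset map are left translates of \<open>H\<close>, hence open, and the
  preimage of any set of cosets is a union of fibres.\<close>

lemma quotient_topology_coset_map_discrete:
  assumes G: "topological_group G T" and H: "subgroup H G" "openin T H"
  shows "quotient_topology T (coset_map G H) = discrete_topology (lcosets\<^bsub>G\<^esub> H)"
proof -
  interpret group G using G by (simp add: topological_group_def)
  have top: "topspace T = carrier G" using G by (simp add: topological_group_def)
  have fibre: "openin T {x \<in> carrier G. coset_map G H x = coset_map G H g}" if g: "g \<in> carrier G" for g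
  proof -
    have "continuous_map T T (\<lambda>x. inv\<^bsub>G\<^esub> g \<otimes>\<^bsub>G\<^esub> x)"
      using g top by (intro topological_group_continuous_mult[OF G]) auto
    from openin_continuous_map_preimage[OF this H(2)]
    have "openin T {x \<in> carrier G. inv\<^bsub>G\<^esub> g \<otimes>\<^bsub>G\<^esub> x \<in> H}" by (simp add: top)
    also have "{x \<in> carrier G. inv\<^bsub>G\<^esub> g \<otimes>\<^bsub>G\<^esub> x \<in> H} = {x \<in> carrier G. coset_map G H x = coset_map G H g}"
      using coset_map_eq_iff[OF H(1) g] by auto
    finally show ?thesis .
  qed
  have "openin T {x \<in> carrier G. coset_map G H x \<in> W}" for W
  proof (subst openin_subopen, intro ballI)
    fix g assume "g \<in> {x \<in> carrier G. coset_map G H x \<in> W}"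
    then show "\<exists>U. openin T U \<and> g \<in> U \<and> U \<subseteq> {x \<in> carrier G. coset_map G H x \<in> W}"
      using fibre[of g] by (intro exI[of _ "{x \<in> carrier G. coset_map G H x = coset_map G H g}"]) auto
  qed
  then show ?thesis
    by (simp add: topology_eq openin_quotient_topology top coset_map_image)
qed

section \<open>Point stabilisers in the symmetric group\<close>

text \<open>A subgroup contains its translate by any of its own elements, so a basic subgroup is
  itself the neighbourhood required at each of its points.\<close>

lemma openin_tau_cont_stab_partition:
  assumes "partition_on X \<gamma>" "\<gamma> \<lesssim> (UNIV :: nat set set)"
  shows "openin (tau_cont X) (stab_partition X \<gamma>)"
proof -
  interpret group "BijGroup X" by (rule group_BijGroup)
  have "stab_partition X \<gamma> \<in> cont_stabs X" using assms by (auto simp: cont_stabs_def)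
  moreover have "x <#\<^bsub>BijGroup X\<^esub> stab_partition X \<gamma> \<subseteq> stab_partition X \<gamma>"
    if "x \<in> stab_partition X \<gamma>" for x
    using that subgroup.m_closed[OF subgroup_stab_partition[OF assms(1)]] by (auto simp: l_coset_def)
  ultimately show ?thesis
    using topological_group_openin_iff[OF tau_cont_properties]
      subgroup.subset[OF subgroup_stab_partition[OF assms(1)]] by blast
qed

text \<open>Removing \<open>{}\<close> covers the case \<open>X = {a}\<close>, where the complement
  of \<open>a\<close> would be an empty block.\<close>

lemma partition_on_insert_Diff:
  assumes "a \<in> X"
  shows "partition_on X ({{a}, X - {a}} - {{}})"
  using assms by (auto simp: partition_on_def pairwise_def disjnt_def)

lemma stab_point_eq_stab_partition:
  assumes "a \<in> X"
  shows "stab_point X a = stab_partition X ({{a}, X - {a}} - {{}})"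
proof -
  have "f a = a \<longleftrightarrow> (\<forall>B\<in>{{a}, X - {a}} - {{}}. f ` B = B)" if f: "f \<in> carrier (BijGroup X)" for f
  proof
    assume fa: "f a = a"
    have "inj_on f X" "f ` X = X" using f by (simp_all add: BijGroup_def Bij_def bij_betw_def)
    then have "f ` (X - {a}) = X - {a}" using fa assms by (simp add: inj_on_image_set_diff)
    then show "\<forall>B\<in>{{a}, X - {a}} - {{}}. f ` B = B"
      using fa by (metis DiffE image_empty image_insert insertE singletonD)
  next
    assume "\<forall>B\<in>{{a}, X - {a}} - {{}}. f ` B = B"
    from bspec[OF this, of "{a}"] show "f a = a" by simp
  qed
  then show ?thesis unfolding stab_point_def stab_partition_def by (intro Collect_cong conj_cong refl)
qed

lemma stab_point_open_subgroup:
  assumes "a \<in> X"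
  shows "subgroup (stab_point X a) (BijGroup X)" "openin (tau_cont X) (stab_point X a)"
proof -
  have "{{a}, X - {a}} - {{}} \<lesssim> (UNIV :: nat set set)"
    by (rule finite_lepoll_infinite) (auto simp: Finite_Set.finite_set)
  with partition_on_insert_Diff[OF assms]
  show "openin (tau_cont X) (stab_point X a)"
    unfolding stab_point_eq_stab_partition[OF assms] by (rule openin_tau_cont_stab_partition)
  show "subgroup (stab_point X a) (BijGroup X)"
    unfolding stab_point_eq_stab_partition[OF assms]
    by (rule subgroup_stab_partition[OF partition_on_insert_Diff[OF assms]])
qed

theorem mainTheorem2:
  fixes X :: "'a set" and a :: 'a
  assumes "(UNIV :: nat set set) \<prec> X" and "a \<in> X"
  shows "let G = BijGroup X; T = tau_cont X; H = stab_point X a;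
             Q = quotient_topology T (coset_map G H)
         in uniformity_compatible (lcosets\<^bsub>G\<^esub> H) (left_uniformity_cosets G T H) Q \<and>
            uniformity_compatible (lcosets\<^bsub>G\<^esub> H) (right_uniformity_cosets G T H) Q \<and>
            uniform_topology (lcosets\<^bsub>G\<^esub> H) (left_uniformity_cosets G T H)
              = discrete_topology (lcosets\<^bsub>G\<^esub> H) \<and>
            uniform_topology (lcosets\<^bsub>G\<^esub> H) (right_uniformity_cosets G T H)
              = discrete_topology (lcosets\<^bsub>G\<^esub> H) \<and>
            Q = discrete_topology (lcosets\<^bsub>G\<^esub> H)"
proof -
  note G = tau_cont_properties(1)[of X]
  note H = stab_point_open_subgroup[OF assms(2)]
  let ?L = "lcosets\<^bsub>BijGroup X\<^esub> (stab_point X a)"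
  have img: "coset_map (BijGroup X) (stab_point X a) ` carrier (BijGroup X) \<subseteq> ?L"
    by (simp add: coset_map_image)
  \<comment> \<open>Compatibility includes being a uniformity. Since the final uniformity is given
    by a definite description, this comes from its existence.\<close>
  have "uniformity_on ?L (left_uniformity_cosets (BijGroup X) (tau_cont X) (stab_point X a))"
    using is_final_uniformity_final_uniformity[OF uniformity_on_left_uniformity[OF G] img]
    by (simp add: is_final_uniformity_def left_uniformity_cosets_def)
  moreover have "uniformity_on ?L (right_uniformity_cosets (BijGroup X) (tau_cont X) (stab_point X a))"
    using is_final_uniformity_final_uniformity[OF uniformity_on_right_uniformity[OF G] img]
    by (simp add: is_final_uniformity_def right_uniformity_cosets_def)
  ultimately show ?thesis
    by (simp add: Let_def uniformity_compatible_def left_uniformity_cosets_discrete[OF G H]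
        right_uniformity_cosets_discrete[OF G H] quotient_topology_coset_map_discrete[OF G H])
qed

end
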